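(* Let $b\ge1$ and $0<\alpha<1$. Let $X_1,X_2,\dots$ be i.i.d. Poisson random variables with mean $\alpha b$, $S_i=X_1+\dots+X_i$, let $B=B_\alpha=\min\{i\ge1:S_i<bi\}$ and $Y_B=S_B-(B-1)b\in\{0,\dots,b-1\}$. Then there exists $R>1$ such that for all complex $q$ with $|q|\le R$ and all $t\in\mathbb C$, $$\mathbb E\bigl(q^Bt^{Y_B}\bigr)=t^b-\prod_{\ell=0}^{b-1}\bigl(t-\zeta_\ell(q)\bigr),$$ and in particular the probability generating function of $B$ is $\psi_B(q)=\mathbb E\,q^B=1-\prod_{\ell=0}^{b-1}(1-\zeta_\ell(q))$.
   Context: $T(z)=\sum_{n\ge1}n^{n-1}z^n/n!$ (converging for $|z|\le e^{-1}$), $\omega=e^{2\pi i/b}$, and for $|q|\le(e^{\alpha-1}/\alpha)^b$, $\zeta_\ell(q)=T(\omega^\ell\alpha e^{-\alpha}q^{1/b})/\alpha$, $\ell=0,\dots,b-1$, for a fixed choice of $q^{1/b}$ (the multiset of the $\zeta_\ell(q)$ does not depend on the choice). $B$ is the length of the first block in one-sided infinite linear probing hashing on buckets $1,2,\dots$ of capacity $b$ with $X_i$ keys hashing to bucket $i$, and $Y_B$ is the number of keys stored in the last bucket of that block. *)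

theory Defs
  imports "HOL-Probability.Probability"
begin

(* The power series sum over n >= 1 of n^(n-1) z^n / n!, with n = Suc k. Its terms are
   absolutely summable for norm z <= exp (-1) only; it is used only there. *)
definition treeT :: "complex \<Rightarrow> complex" where
  "treeT z = (\<Sum>k. of_nat (Suc k ^ k) / fact (Suc k) * z ^ Suc k)"

(* The argument r stands for the chosen root q^(1/b), i.e. any r with r^b = q. *)
definition zeta :: "nat \<Rightarrow> real \<Rightarrow> complex \<Rightarrow> nat \<Rightarrow> complex" where
  "zeta b \<alpha> r l =
     treeT (exp (2 * of_real pi * \<i> / of_nat b) ^ l * of_real (\<alpha> * exp (- \<alpha>)) * r)
       / of_real \<alpha>"

(* The sequence X is used at the indices 1, 2, ...; X 0 plays no role. *)
definition partial_sum :: "(nat \<Rightarrow> 'a \<Rightarrow> nat) \<Rightarrow> nat \<Rightarrow> 'a \<Rightarrow> nat" where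
  "partial_sum X i x = (\<Sum>j=1..i. X j x)"

definition block_ends :: "nat \<Rightarrow> (nat \<Rightarrow> 'a \<Rightarrow> nat) \<Rightarrow> 'a \<Rightarrow> bool" where
  "block_ends b X x \<longleftrightarrow> (\<exists>i\<ge>1. partial_sum X i x < b * i)"

(* Unspecified where block_ends fails. *)
definition block_length :: "nat \<Rightarrow> (nat \<Rightarrow> 'a \<Rightarrow> nat) \<Rightarrow> 'a \<Rightarrow> nat" where
  "block_length b X x = (LEAST i. i \<ge> 1 \<and> partial_sum X i x < b * i)"

(* The subtractions do not truncate where block_ends holds, see last_bucket_eq. *)
definition last_bucket :: "nat \<Rightarrow> (nat \<Rightarrow> 'a \<Rightarrow> nat) \<Rightarrow> 'a \<Rightarrow> nat" where
  "last_bucket b X x =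
     partial_sum X (block_length b X x) x - (block_length b X x - 1) * b"

lemma block_length_props:
  assumes "block_ends b X x"
  shows "block_length b X x \<ge> 1"
    and "partial_sum X (block_length b X x) x < b * block_length b X x"
    and "(block_length b X x - 1) * b \<le> partial_sum X (block_length b X x) x"
proof -
  let ?P = "\<lambda>i. i \<ge> 1 \<and> partial_sum X i x < b * i"
  let ?B = "block_length b X x"
  have ex: "\<exists>i. ?P i" using assms by (auto simp: block_ends_def)
  have P: "?P ?B" unfolding block_length_def using LeastI_ex[OF ex] .
  then show B1: "?B \<ge> 1" and "partial_sum X ?B x < b * ?B" by auto
  have "\<not> ?P (?B - 1)"
    using B1 not_less_Least[of "?B - 1" ?P] unfolding block_length_def by simp
  then have "(?B - 1) * b \<le> partial_sum X (?B - 1) x"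
    by (cases "?B - 1 = 0") (auto simp: not_less mult.commute)
  also have "\<dots> \<le> partial_sum X ?B x"
    unfolding partial_sum_def by (intro sum_mono2) auto
  finally show "(?B - 1) * b \<le> partial_sum X ?B x" .
qed

lemma last_bucket_eq:
  assumes "block_ends b X x"
  shows "int (last_bucket b X x) =
      int (partial_sum X (block_length b X x) x) - (int (block_length b X x) - 1) * int b"
    and "last_bucket b X x < b"
proof -
  show *: "int (last_bucket b X x) =
      int (partial_sum X (block_length b X x) x) - (int (block_length b X x) - 1) * int b"
    using block_length_props[OF assms] by (simp add: last_bucket_def of_nat_diff)
  have "int (partial_sum X (block_length b X x) x) < int b * int (block_length b X x)"
    using block_length_props(2)[OF assms] by (metis of_nat_less_iff of_nat_mult)
  with * have "int (last_bucket b X x) < int b" by (simp add: algebra_simps)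
  then show "last_bucket b X x < b" by simp
qed

end

theory Submission
  imports Defs
begin

text \<open>
  The tree function satisfies $T(w) e^{-T(w)} = w$ and $|T(w)| < 1$ for $|w| < e^{-1}$. Hence, for
  $q = r^b \neq 0$ with $|q| < (e^{\alpha-1}/\alpha)^b$, the $\zeta_\ell$ are $b$ distinct roots
  of $z^b = q e^{\alpha b (z - 1)}$ with $|z| \le 1/\alpha$. For such a root, $(q z^{-b})^n z^{S_n}$
  is a martingale, and stopping it at time $B$ gives $E(q^B z^{Y_B}) = z^b$. So the monic
  polynomial $t^b - E(q^B t^{Y_B})$ of degree $b$ vanishes exactly at the $\zeta_\ell$. Optional
  stopping is justified by comparison with the same martingale at $z = 1/\alpha$,
  $q = (e^{\alpha-1}/\alpha)^b$, which is positive and dominates all the others.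
\<close>

section \<open>Finite differences and Abel's binomial identity\<close>

text \<open>Up to sign this is an \<open>m\<close>-th finite difference of a polynomial of degree
  below \<open>m\<close>. Pascal's rule removes one difference and replaces \<open>k ^ i\<close> by
  \<open>(1 + k) ^ i - k ^ i\<close>, whose degree in \<open>k\<close> is below \<open>i\<close>, so
  induction on \<open>m\<close> applies.\<close>

lemma alternating_binomial_power_sum:
  assumes "i < m"
  shows "(\<Sum>k\<le>m. (-1) ^ k * of_nat (m choose k) * of_nat k ^ i) = (0 :: 'a :: comm_ring_1)"
  using assms
proof (induction m arbitrary: i)
  case (Suc m)
  define f where "f = (\<lambda>k. (-1) ^ k * of_nat (m choose k) :: 'a)"
  have "(\<Sum>k\<le>Suc m. (-1) ^ k * of_nat (Suc m choose k) * of_nat k ^ i)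
      = (\<Sum>k\<le>Suc m. (-1) ^ k * of_nat (m choose k) * (of_nat k ^ i :: 'a))
        + (\<Sum>k\<le>m. (-1) ^ Suc k * of_nat (m choose k) * of_nat (Suc k) ^ i)"
    unfolding sum.atMost_Suc_shift[of _ m]
    by (simp add: algebra_simps flip: sum.distrib)
  also have "\<dots> = - (\<Sum>k\<le>m. f k * ((1 + of_nat k) ^ i - of_nat k ^ i))"
    by (simp add: f_def binomial_eq_0 algebra_simps flip: sum.distrib sum_negf)
  also have "(\<Sum>k\<le>m. f k * ((1 + of_nat k) ^ i - of_nat k ^ i))
      = (\<Sum>k\<le>m. \<Sum>j<i. of_nat (i choose j) * (f k * of_nat k ^ j))"
  proof (intro sum.cong refl)
    fix k
    have "(1 + of_nat k) ^ i = (\<Sum>j\<le>i. of_nat (i choose j) * (of_nat k ^ j :: 'a))"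
      by (subst add.commute) (simp add: binomial_ring)
    also have "\<dots> = (\<Sum>j<i. of_nat (i choose j) * (of_nat k ^ j :: 'a)) + of_nat k ^ i"
      by (simp flip: lessThan_Suc_atMost)
    finally show "f k * ((1 + of_nat k) ^ i - of_nat k ^ i)
        = (\<Sum>j<i. of_nat (i choose j) * (f k * of_nat k ^ j))"
      by (simp add: sum_distrib_left mult_ac)
  qed
  also have "\<dots> = (\<Sum>j<i. of_nat (i choose j) * (\<Sum>k\<le>m. f k * of_nat k ^ j))"
    by (subst sum.swap) (simp add: sum_distrib_left)
  also have "\<dots> = 0"
    using Suc by (intro sum.neutral) (auto simp: f_def)
  finally show ?case by simp
qed simp

text \<open>Both sides count ordered pairs of disjoint subsets of sizes \<open>k\<close> and
  \<open>j\<close>. This is what allows the double sum in Abel's identity to be regrouped.\<close>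

lemma binomial_mult_swap:
  "(n choose k) * ((n - k) choose j) = (n choose j) * ((n - j) choose k)"
proof (cases "k + j \<le> n")
  case True
  then have "((n choose k) * ((n - k) choose j)) * (fact k * fact j * fact (n - k - j)) = fact n"
    using binomial_fact_lemma[of k n, symmetric] binomial_fact_lemma[of j "n - k", symmetric]
    by (simp add: mult_ac)
  moreover have
    "((n choose j) * ((n - j) choose k)) * (fact k * fact j * fact (n - k - j)) = fact n"
    using True binomial_fact_lemma[of j n, symmetric] binomial_fact_lemma[of k "n - j", symmetric]
    by (simp add: mult_ac diff_commute add.commute)
  ultimately have "(n choose k) * ((n - k) choose j) * (fact k * fact j * fact (n - k - j))
      = (n choose j) * ((n - j) choose k) * (fact k * fact j * fact (n - k - j))"
    by (rule trans[OF _ sym])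
  then show ?thesis
    by (simp only: mult_cancel2) simp
next
  case False
  then have "n < k \<or> n - k < j" "n < j \<or> n - j < k"
    by auto
  then show ?thesis
    by (auto simp: binomial_eq_0)
qed

text \<open>Abel's identity $\sum_k \binom{n}{k} x (x+k)^{k-1} (y-k)^{n-k} = (x+y)^n$, differentiated
  at $x = 0$.\<close>

lemma abel_identity:
  fixes y :: "'a :: comm_ring_1"
  assumes "n \<ge> 1"
  shows "(\<Sum>k=1..n. of_nat (n choose k) * of_nat k ^ (k - 1) * (y - of_nat k) ^ (n - k))
           = of_nat n * y ^ (n - 1)"
proof -
  \<comment> \<open>Expanding \<open>(y - k) ^ (n - k)\<close> in powers of \<open>y\<close> and
    collecting the coefficient of \<open>y ^ j\<close> leaves \<open>k\<close> to the power
    \<open>n - j - 1\<close>, one below the order \<open>n - j\<close> of the alternating sum. Hence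
    only \<open>j = n - 1\<close> will survive.\<close>
  let ?g = "\<lambda>j k. of_nat (n choose j) * y ^ j *
              ((-1) ^ (n - j) * ((-1) ^ k * of_nat ((n - j) choose k) * of_nat k ^ (n - j - 1)))"
  have "(\<Sum>k=1..n. of_nat (n choose k) * of_nat k ^ (k - 1) * (y - of_nat k) ^ (n - k))
      = (\<Sum>k=1..n. \<Sum>j\<le>n. ?g j k)"
  proof (intro sum.cong refl)
    fix k assume k: "k \<in> {1..n}"
    have "(y - of_nat k) ^ (n - k)
        = (\<Sum>j\<le>n - k. of_nat ((n - k) choose j) * y ^ j * (- of_nat k) ^ (n - k - j))"
      using binomial_ring[of y "- of_nat k" "n - k"] by simp
    also have "\<dots> = (\<Sum>j\<le>n. of_nat ((n - k) choose j) * y ^ j * (- of_nat k) ^ (n - k - j))"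
      by (intro sum.mono_neutral_left) (auto simp: binomial_eq_0)
    finally show "of_nat (n choose k) * of_nat k ^ (k - 1) * (y - of_nat k) ^ (n - k)
        = (\<Sum>j\<le>n. ?g j k)"
    proof (simp only: sum_distrib_left, intro sum.cong refl)
      fix j
      show "of_nat (n choose k) * of_nat k ^ (k - 1) *
          (of_nat ((n - k) choose j) * y ^ j * (- of_nat k) ^ (n - k - j)) = ?g j k"
      proof (cases "k + j \<le> n")
        case True
        have e: "n - j - 1 = (k - 1) + (n - k - j)" "n - j = (n - k - j) + k"
          using True k by auto
        have p: "of_nat k ^ (n - j - 1) = of_nat k ^ (k - 1) * (of_nat k ^ (n - k - j) :: 'a)"
          unfolding e(1) power_add ..
        have s: "(-1) ^ (n - j) * (-1) ^ k = ((-1) ^ (n - k - j) :: 'a)"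
          unfolding e(2) power_add by (simp add: mult.assoc flip: power_mult_distrib)
        have "?g j k = of_nat ((n choose j) * ((n - j) choose k)) * y ^ j *
            ((-1) ^ (n - j) * (-1) ^ k * of_nat k ^ (n - j - 1))"
          by (simp add: mult_ac)
        also have "\<dots> = of_nat ((n choose k) * ((n - k) choose j)) * y ^ j *
            ((-1) ^ (n - k - j) * (of_nat k ^ (k - 1) * of_nat k ^ (n - k - j)))"
          by (simp only: p s binomial_mult_swap)
        finally show ?thesis
          by (simp add: power_minus[of "of_nat k"] mult_ac)
      next
        case False
        then have "n - k < j" "n - j < k"
          using k by auto
        then show ?thesis by (simp only: binomial_eq_0) simp
      qed
    qed
  qed
  also have "\<dots> = (\<Sum>j\<le>n. of_nat (n choose j) * y ^ j * (if n - j = 1 then 1 else 0))"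
  proof (subst sum.swap, intro sum.cong refl)
    fix j assume "j \<in> {..n}"
    define m where "m = n - j"
    have "(\<Sum>k=1..n. (-1) ^ k * of_nat (m choose k) * of_nat k ^ (m - 1))
        = (\<Sum>k=1..m. (-1) ^ k * of_nat (m choose k) * (of_nat k ^ (m - 1) :: 'a))"
      by (intro sum.mono_neutral_right) (auto simp: m_def binomial_eq_0)
    also have "(-1) ^ m * \<dots> = (if m = 1 then 1 else 0)"
    proof (cases "m = 0")
      case False
      then have "0 = (\<Sum>k\<le>m. (-1) ^ k * of_nat (m choose k) * (of_nat k ^ (m - 1) :: 'a))"
        by (intro alternating_binomial_power_sum[symmetric]) simp
      \<comment> \<open>The sum in question starts at \<open>k = 1\<close>, so it is minus the
        missing term at \<open>k = 0\<close>. That term is \<open>0 ^ (m - 1)\<close>, which is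
        nonzero only for \<open>m = 1\<close>.\<close>
      also have "\<dots> = 0 ^ (m - 1)
          + (\<Sum>k=1..m. (-1) ^ k * of_nat (m choose k) * of_nat k ^ (m - 1))"
        by (simp add: atMost_atLeast0 sum.atLeast_Suc_atMost)
      finally show ?thesis
        using False by (cases "m = 1") (auto simp: power_0_left)
    qed simp
    finally show "(\<Sum>k=1..n. ?g j k) = of_nat (n choose j) * y ^ j * (if n - j = 1 then 1 else 0)"
      by (simp only: m_def flip: sum_distrib_left)
  qed
  also have "\<dots> = (\<Sum>j\<in>{n - 1}. of_nat (n choose j) * y ^ j * (if n - j = 1 then 1 else 0))"
    using assms by (intro sum.mono_neutral_right) auto
  also have "\<dots> = of_nat n * y ^ (n - 1)"
    using assms binomial_symmetric[of "n - 1" n] by simp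
  finally show ?thesis .
qed

section \<open>The tree function: formal series, convergence and functional equation\<close>

text \<open>The exponential generating function of rooted labelled trees. The index 0 is treated
  apart because truncated subtraction would make its coefficient 1. The type is left generic since
  both the real and the complex series occur.\<close>

definition tree_fps :: "'a :: field_char_0 fps" where
  "tree_fps = Abs_fps (\<lambda>n. if n = 0 then 0 else of_nat n ^ (n - 1) / fact n)"

lemma tree_fps_nth_0 [simp]: "fps_nth tree_fps 0 = 0"
  by (simp add: tree_fps_def)

lemma tree_fps_nth_Suc [simp]: "fps_nth tree_fps (Suc n) = of_nat (Suc n) ^ n / fact (Suc n)"
  by (simp add: tree_fps_def)

lemma tree_fps_deriv_nth:
  "fps_nth (1 + fps_X * fps_deriv tree_fps) n = (of_nat n ^ n / fact n :: 'a :: field_char_0)"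
  by (cases n) (simp_all del: of_nat_Suc add: field_simps)

text \<open>This is the equation \<open>T * exp (- T) = z\<close> after logarithmic differentiation.
  Comparing coefficients, the convolution on the left is Abel's identity at
  \<open>y = n\<close>.\<close>

lemma tree_fps_ode:
  "tree_fps * (1 + fps_X * fps_deriv tree_fps) = fps_X * fps_deriv (tree_fps :: 'a :: field_char_0 fps)"
proof (rule fps_ext)
  fix n
  let ?D = "1 + fps_X * fps_deriv tree_fps :: 'a fps"
  show "fps_nth (tree_fps * ?D) n = fps_nth (fps_X * fps_deriv tree_fps :: 'a fps) n"
  proof (cases "n = 0")
    case False
    have "fps_nth (tree_fps * ?D) n = (\<Sum>k=0..n. fps_nth tree_fps k * fps_nth ?D (n - k))"
      by (rule fps_mult_nth)
    also have "\<dots> = (\<Sum>k=1..n. fps_nth tree_fps k * fps_nth ?D (n - k))"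
      by (simp only: sum.atLeast_Suc_atMost[OF le0] tree_fps_nth_0 mult_zero_left add_0_left
          One_nat_def)
    also have "\<dots> = (\<Sum>k=1..n. of_nat (n choose k) * of_nat k ^ (k - 1) * (of_nat n - of_nat k) ^ (n - k)) / fact n"
      unfolding sum_divide_distrib tree_fps_deriv_nth
      by (intro sum.cong refl) (auto simp: tree_fps_def binomial_fact of_nat_diff field_simps)
    also have "\<dots> = of_nat n * of_nat n ^ (n - 1) / fact n"
      using False by (subst abel_identity) auto
    also have "\<dots> = fps_nth ?D n"
      using False unfolding tree_fps_deriv_nth by (cases n) auto
    also have "\<dots> = fps_nth (fps_X * fps_deriv tree_fps :: 'a fps) n"
      using False by simp
    finally show ?thesis .
  qed simp
qed

text \<open>Since \<open>n ^ n / fact n\<close> is a single term of the exponential series at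
  \<open>n\<close>, the coefficients are at most \<open>exp 1 ^ n\<close>, and a geometric series
  dominates.\<close>

lemma fps_conv_radius_tree:
  "fps_conv_radius (tree_fps :: 'a :: {real_normed_field, banach} fps) \<ge> exp (-1)"
  unfolding fps_conv_radius_def
proof (rule conv_radius_geI_ex')
  fix r :: real assume r: "0 < r" "ereal r < ereal (exp (-1))"
  show "summable (\<lambda>n. fps_nth tree_fps n * of_real r ^ n :: 'a)"
  proof (rule summable_comparison_test)
    have "exp 1 * r < exp 1 * exp (-1)" using r by simp
    then show "summable (\<lambda>n. (exp 1 * r) ^ n)"
      using r by (intro summable_geometric) (simp flip: exp_add)
    have "norm (fps_nth tree_fps n :: 'a) \<le> exp 1 ^ n" for n
    proof (cases n)
      case (Suc k)
      have "norm (fps_nth tree_fps n :: 'a) = real n ^ k / fact n"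
        by (simp add: Suc norm_divide norm_power del: of_nat_Suc fact_Suc)
      also have "\<dots> \<le> real n ^ n / fact n"
        by (intro divide_right_mono power_increasing) (auto simp: Suc)
      also have "\<dots> \<le> exp (real n)"
        using sum_le_suminf[OF summable_exp_generic[of "real n"], of "{n}"]
        by (simp add: exp_def divide_inverse mult.commute)
      finally show ?thesis by (simp flip: exp_of_nat_mult)
    qed simp
    then show "\<exists>N. \<forall>n\<ge>N. norm (fps_nth tree_fps n * of_real r ^ n :: 'a) \<le> (exp 1 * r) ^ n"
      using r by (auto simp: norm_mult norm_power power_mult_distrib intro!: exI[of _ 0] mult_right_mono)
  qed
qed

lemma less_fps_conv_radius_tree:
  fixes z :: "'a :: {real_normed_field, banach}"
  assumes "norm z < exp (-1)"
  shows "ereal (norm z) < fps_conv_radius (tree_fps :: 'a fps)"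
  using assms fps_conv_radius_tree[where 'a = 'a] by (meson less_le_trans less_ereal.simps(1))

lemma treeT_eq_eval_fps:
  assumes "norm z < exp (-1)"
  shows "treeT z = eval_fps tree_fps z"
  unfolding eval_fps_def treeT_def
  using suminf_split_head[OF summable_fps[OF less_fps_conv_radius_tree[OF assms]]]
  by (simp del: of_nat_Suc)

text \<open>Writing T = z P, the differential equation becomes P' = T' P, so
  \<open>P * exp (- T)\<close> has derivative 0 on the disc. Splitting off the factor z makes the
  constant visible at the origin: it is the linear coefficient 1 of T.\<close>

lemma eval_tree_fps_functional_equation:
  fixes z :: "'a :: {real_normed_field, banach}"
  assumes "norm z < exp (-1)"
  shows "eval_fps tree_fps z * exp (- eval_fps tree_fps z) = z"
proof -
  define P where "P = fps_shift 1 (tree_fps :: 'a fps)"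
  let ?B = "ball (0 :: 'a) (exp (-1))"
  have T: "tree_fps = fps_X * P"
    by (rule fps_ext) (simp add: P_def)
  have "fps_X * (fps_X * (fps_deriv P - fps_deriv tree_fps * P)) = 0"
    using tree_fps_ode[where 'a = 'a] by (simp add: T algebra_simps)
  then have P': "fps_deriv P = fps_deriv tree_fps * P"
    by simp
  have r: "ereal (norm w) < fps_conv_radius (tree_fps :: 'a fps)"
    "ereal (norm w) < fps_conv_radius (fps_deriv tree_fps :: 'a fps)"
    "ereal (norm w) < fps_conv_radius P" if "w \<in> ?B" for w
    using that less_fps_conv_radius_tree[of w] fps_conv_radius_deriv[of "tree_fps :: 'a fps"]
    by (auto simp: P_def intro: less_le_trans)
  have "((\<lambda>w. eval_fps P w * exp (- eval_fps tree_fps w)) has_field_derivative 0) (at w within ?B)"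
    if "w \<in> ?B" for w
    by (rule derivative_eq_intros has_field_derivative_eval_fps r that refl)+
      (simp add: P' eval_fps_mult[OF r(2,3)[OF that]])
  then have "\<exists>c. \<forall>w\<in>?B. eval_fps P w * exp (- eval_fps tree_fps w) = c"
    by (rule has_field_derivative_zero_constant[OF convex_ball])
  then obtain c where c: "eval_fps P w * exp (- eval_fps tree_fps w) = c" if "w \<in> ?B" for w
    by blast
  from c[of 0] have "c = 1"
    by (simp add: eval_fps_at_0 P_def)
  with c[of z] assms have "eval_fps P z * exp (- eval_fps tree_fps z) = 1"
    by simp
  moreover have "eval_fps tree_fps z = z * eval_fps P z"
    using assms r(3)[of z] by (simp add: T eval_fps_mult)
  ultimately show ?thesis
    by (simp add: mult.assoc)
qed

text \<open>If the value 1 were reached or exceeded, continuity from T(0) = 0 would give some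
  \<open>y \<le> x\<close> with T(y) = 1, and the functional equation would force
  \<open>y = exp (-1)\<close>.\<close>

lemma eval_tree_fps_less_1:
  fixes x :: real
  assumes "0 \<le> x" "x < exp (-1)"
  shows "eval_fps tree_fps x < 1"
proof (rule ccontr)
  assume "\<not> ?thesis"
  moreover have "{0..x} \<subseteq> eball 0 (fps_conv_radius (tree_fps :: real fps))"
  proof
    fix w assume "w \<in> {0..x}"
    with assms less_fps_conv_radius_tree[of w] show "w \<in> eball 0 (fps_conv_radius (tree_fps :: real fps))"
      by (simp add: in_eball_iff)
  qed
  then have "continuous_on {0..x} (eval_fps tree_fps)"
    by (rule continuous_on_subset[OF continuous_on_eval_fps])
  ultimately obtain y where y: "0 \<le> y" "y \<le> x" "eval_fps tree_fps y = 1"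
    using IVT'[of "eval_fps tree_fps" 0 1 x] assms by (auto simp: eval_fps_at_0)
  with assms eval_tree_fps_functional_equation[of y] show False
    by simp
qed

lemma treeT_functional_equation:
  "norm z < exp (-1) \<Longrightarrow> treeT z * exp (- treeT z) = z"
  by (simp add: treeT_eq_eval_fps eval_tree_fps_functional_equation)

text \<open>The coefficients are nonnegative, so |T(z)| is at most T(|z|), which reduces the claim
  to the real case.\<close>

lemma norm_treeT_less_1:
  assumes "norm z < exp (-1)"
  shows "norm (treeT z) < 1"
proof -
  have s: "summable (\<lambda>n. norm (fps_nth tree_fps n * z ^ n))"
    by (intro norm_summable_fps less_fps_conv_radius_tree assms)
  have "norm (treeT z) \<le> (\<Sum>n. norm (fps_nth tree_fps n * z ^ n))"
    unfolding treeT_eq_eval_fps[OF assms] eval_fps_def by (rule summable_norm[OF s])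
  also have "\<dots> = eval_fps tree_fps (norm z)"
    unfolding eval_fps_def
    by (intro suminf_cong) (simp add: tree_fps_def norm_mult norm_power norm_divide)
  also have "\<dots> < 1"
    using assms by (intro eval_tree_fps_less_1) auto
  finally show ?thesis .
qed

section \<open>The values \<open>zeta\<close> as roots of the characteristic equation\<close>

text \<open>The functional equation of T is rescaled by \<alpha>. The hypothesis on \<open>r\<close>
  says exactly that the argument of \<open>treeT\<close> lies in the open disc of radius
  \<open>exp (-1)\<close>, and the norm bound is |T| < 1.\<close>

lemma zeta_fixed_point:
  fixes b l :: nat and r :: complex
  assumes "0 < \<alpha>" and "norm r < exp (\<alpha> - 1) / \<alpha>"
  defines "\<omega> \<equiv> exp (2 * of_real pi * \<i> / of_nat b)"
  shows "zeta b \<alpha> r l = \<omega> ^ l * r * exp (of_real \<alpha> * (zeta b \<alpha> r l - 1))"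
    and "norm (zeta b \<alpha> r l) \<le> 1 / \<alpha>"
proof -
  define w where "w = \<omega> ^ l * of_real (\<alpha> * exp (- \<alpha>)) * r"
  have T: "treeT w = of_real \<alpha> * zeta b \<alpha> r l"
    using assms by (simp add: zeta_def w_def)
  have "norm \<omega> = 1"
    by (simp add: \<omega>_def)
  then have "norm w = \<alpha> * exp (- \<alpha>) * norm r"
    using assms(1) by (simp add: w_def norm_mult norm_power)
  also have "\<dots> < \<alpha> * exp (- \<alpha>) * (exp (\<alpha> - 1) / \<alpha>)"
    using assms by (intro mult_strict_left_mono) auto
  also have "\<dots> = exp (-1)"
    using assms(1) by (simp flip: exp_add)
  finally have w: "norm w < exp (-1)" .
  have "\<alpha> * norm (zeta b \<alpha> r l) < 1"
    using norm_treeT_less_1[OF w] assms(1) by (simp add: T norm_mult)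
  then show "norm (zeta b \<alpha> r l) \<le> 1 / \<alpha>"
    using assms(1) by (simp add: field_simps)
  have "of_real \<alpha> * zeta b \<alpha> r l = w * exp (treeT w)"
    using treeT_functional_equation[OF w] by (simp add: T exp_minus field_simps)
  also have "\<dots> = of_real \<alpha> * (\<omega> ^ l * r * (exp (- of_real \<alpha>) * exp (treeT w)))"
    by (simp add: w_def flip: exp_of_real)
  finally show "zeta b \<alpha> r l = \<omega> ^ l * r * exp (of_real \<alpha> * (zeta b \<alpha> r l - 1))"
    using assms(1) by (simp add: T algebra_simps flip: exp_add)
qed

lemma zeta_power:
  assumes "b \<ge> 1" "0 < \<alpha>" "norm r < exp (\<alpha> - 1) / \<alpha>"
  shows "zeta b \<alpha> r l ^ b = r ^ b * exp (of_real (\<alpha> * real b) * (zeta b \<alpha> r l - 1))"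
proof -
  let ?\<omega> = "exp (2 * of_real pi * \<i> / of_nat b) :: complex"
  have "(?\<omega> ^ l) ^ b = (?\<omega> ^ b) ^ l"
    by (simp flip: power_mult add: mult.commute)
  also have "?\<omega> ^ b = 1"
    using assms(1) by (simp flip: exp_of_nat_mult)
  finally have "(?\<omega> ^ l) ^ b = 1"
    by simp
  then show ?thesis
    by (subst zeta_fixed_point(1)[OF assms(2,3)])
      (simp add: power_mult_distrib exp_of_nat_mult[symmetric] mult_ac)
qed

lemma zeta_neq_0:
  assumes "0 < \<alpha>" "norm r < exp (\<alpha> - 1) / \<alpha>" "r \<noteq> 0"
  shows "zeta b \<alpha> r l \<noteq> 0"
  using assms by (subst zeta_fixed_point(1)[OF assms(1,2)]) simp

text \<open>Equal values have the same exponential factor in their fixed point equations. Cancelling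
  it together with \<open>r\<close> leaves equal powers of a primitive \<open>b\<close>-th root of
  unity.\<close>

lemma inj_on_zeta:
  assumes "0 < \<alpha>" "norm r < exp (\<alpha> - 1) / \<alpha>" "r \<noteq> 0"
  shows "inj_on (zeta b \<alpha> r) {..<b}"
proof (rule inj_onI)
  fix l m assume lm: "l \<in> {..<b}" "m \<in> {..<b}" and eq: "zeta b \<alpha> r l = zeta b \<alpha> r m"
  let ?\<omega> = "exp (2 * of_real pi * \<i> / of_nat b) :: complex"
  let ?c = "r * exp (of_real \<alpha> * (zeta b \<alpha> r m - 1))"
  have "zeta b \<alpha> r m = ?\<omega> ^ l * ?c" "zeta b \<alpha> r m = ?\<omega> ^ m * ?c"
    using zeta_fixed_point(1)[OF assms(1,2), of b l] zeta_fixed_point(1)[OF assms(1,2), of b m]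
    by (simp_all only: eq mult.assoc)
  then have "?\<omega> ^ l * ?c = ?\<omega> ^ m * ?c"
    by (rule trans[OF sym])
  then have "?\<omega> ^ l = ?\<omega> ^ m"
    using assms(3) by (simp only: mult_right_cancel mult_eq_0_iff exp_not_eq_zero simp_thms)
  then have "exp (2 * of_real pi * \<i> * of_nat l / of_nat b) = exp (2 * of_real pi * \<i> * of_nat m / of_nat b)"
    by (simp flip: exp_of_nat_mult add: mult_ac)
  then show "l = m"
    using lm complex_root_unity_eq[of b l m] by (auto simp: cong_def)
qed

section \<open>The generating function of the Poisson law\<close>

text \<open>The field is generic because the real point 1/\<alpha> is needed for the tail bound and
  complex points for the roots.\<close>

lemma poisson_pgf:
  fixes z :: "'a :: {real_normed_field, banach, second_countable_topology}"
  assumes "c > 0"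
  shows "integrable (measure_pmf (poisson_pmf c)) (\<lambda>k. z ^ k)"
    and "(\<integral>k. z ^ k \<partial>measure_pmf (poisson_pmf c)) = exp (of_real c * (z - 1))"
proof -
  have eq: "pmf (poisson_pmf c) k *\<^sub>R z ^ k = exp (-c) *\<^sub>R ((of_real c * z) ^ k /\<^sub>R fact k)" for k
    using assms by (simp add: power_mult_distrib scaleR_conv_of_real divide_inverse mult_ac)
  have i: "integrable (count_space UNIV) (\<lambda>k. pmf (poisson_pmf c) k *\<^sub>R z ^ k)"
    unfolding integrable_count_space_nat_iff eq norm_scaleR
    by (intro summable_mult summable_norm_exp[unfolded norm_scaleR])
  then show "integrable (measure_pmf (poisson_pmf c)) (\<lambda>k. z ^ k)"
    by (simp add: measure_pmf_eq_density integrable_density)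
  have "(\<integral>k. z ^ k \<partial>measure_pmf (poisson_pmf c)) = (\<Sum>k. pmf (poisson_pmf c) k *\<^sub>R z ^ k)"
    using integral_count_space_nat[OF i] by (simp add: measure_pmf_eq_density integral_density)
  also have "\<dots> = exp (-c) *\<^sub>R exp (of_real c * z)"
    unfolding eq by (intro sums_unique[symmetric] sums_scaleR_right exp_converges)
  also have "\<dots> = exp (of_real c * (z - 1))"
    by (simp add: scaleR_conv_of_real exp_of_real[symmetric] algebra_simps flip: exp_add)
  finally show "(\<integral>k. z ^ k \<partial>measure_pmf (poisson_pmf c)) = exp (of_real c * (z - 1))" .
qed

section \<open>The block length and the events that it exceeds \<open>n\<close>\<close>

locale linear_probing = prob_space M for M :: "'a measure" +
  fixes X :: "nat \<Rightarrow> 'a \<Rightarrow> nat" and b :: nat and \<alpha> :: real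
  assumes b: "b \<ge> 1" and \<alpha>: "0 < \<alpha>" "\<alpha> < 1"
    and indep: "indep_vars (\<lambda>_. count_space UNIV) X {1..}"
    and distr: "\<And>i. i \<ge> 1 \<Longrightarrow>
      distr M (count_space UNIV) (X i) = measure_pmf (poisson_pmf (\<alpha> * real b))"
begin

abbreviation S :: "nat \<Rightarrow> 'a \<Rightarrow> nat" where "S \<equiv> partial_sum X"
abbreviation B :: "'a \<Rightarrow> nat" where "B \<equiv> block_length b X"
abbreviation Y :: "'a \<Rightarrow> nat" where "Y \<equiv> last_bucket b X"

text \<open>The event \<open>B > n\<close>, phrased through partial sums: it is determined by
  \<open>X 1\<close> to \<open>X n\<close>, and it contains the points where the block never ends,
  at which \<open>B\<close> is unspecified.\<close>

definition longer :: "nat \<Rightarrow> 'a set" where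
  "longer n = {x \<in> space M. \<forall>i\<in>{1..n}. b * i \<le> S i x}"

text \<open>At \<open>norm q = radius\<close> the arguments of \<open>treeT\<close> reach the circle
  of radius \<open>exp (-1)\<close>.\<close>

definition radius :: real where
  "radius = (exp (\<alpha> - 1) / \<alpha>) ^ b"

text \<open>The inequality \<open>ln \<alpha> \<le> \<alpha> - 1\<close> is strict because \<alpha>
  differs from 1.\<close>

lemma radius_gt_1: "1 < radius"
proof -
  have "\<alpha> < exp (\<alpha> - 1)"
    using \<alpha> ln_le_minus_one[of \<alpha>] ln_eq_minus_one[of \<alpha>]
    by (metis exp_less_cancel_iff exp_ln less_irrefl order_less_le)
  then show ?thesis
    unfolding radius_def using \<alpha> b by (intro one_less_power) auto
qed

lemma X_measurable [measurable]: "1 \<le> i \<Longrightarrow> X i \<in> M \<rightarrow>\<^sub>M count_space UNIV"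
  using indep by (auto simp: indep_vars_def)

lemma S_measurable [measurable]: "S i \<in> M \<rightarrow>\<^sub>M count_space UNIV"
proof -
  have "(\<lambda>x. \<Sum>j=1..i. X j x) \<in> M \<rightarrow>\<^sub>M count_space UNIV"
    by measurable
  then show ?thesis
    by (simp add: partial_sum_def[abs_def])
qed

lemma B_measurable [measurable]: "B \<in> M \<rightarrow>\<^sub>M count_space UNIV"
  unfolding block_length_def[abs_def] by measurable

lemma Y_measurable [measurable]: "Y \<in> M \<rightarrow>\<^sub>M count_space UNIV"
  unfolding last_bucket_def[abs_def]
  by (rule measurable_compose_countable[OF _ B_measurable]) measurable

lemma longer_sets [measurable]: "longer n \<in> sets M"
  unfolding longer_def by measurable

lemma longer_0 [simp]: "longer 0 = space M"
  by (simp add: longer_def)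

lemma longer_Suc: "longer (Suc n) = {x \<in> longer n. b * Suc n \<le> S (Suc n) x}"
  by (auto simp: longer_def atLeastAtMostSuc_conv)

lemma longer_le: "x \<in> longer n \<Longrightarrow> b * n \<le> S n x"
  by (cases "n = 0") (auto simp: longer_def)

lemma longer_iff:
  "x \<in> longer n \<longleftrightarrow> x \<in> space M \<and> (block_ends b X x \<longrightarrow> n < B x)"
proof (cases "block_ends b X x")
  case True
  have "(\<forall>i\<in>{1..n}. b * i \<le> S i x) \<longleftrightarrow> n < B x"
  proof
    assume *: "\<forall>i\<in>{1..n}. b * i \<le> S i x"
    show "n < B x"
    proof (rule ccontr)
      assume "\<not> n < B x"
      with * block_length_props(1,2)[OF True] show False
        by (meson atLeastAtMost_iff linorder_not_less)
    qed
  next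
    assume "n < B x"
    show "\<forall>i\<in>{1..n}. b * i \<le> S i x"
    proof
      fix i assume i: "i \<in> {1..n}"
      with \<open>n < B x\<close> have "\<not> (i \<ge> 1 \<and> S i x < b * i)"
        unfolding block_length_def by (intro not_less_Least) auto
      with i show "b * i \<le> S i x"
        by auto
    qed
  qed
  with True show ?thesis
    by (auto simp: longer_def)
qed (auto simp: longer_def block_ends_def not_less)

section \<open>The exponential martingale and tail bounds for the block length\<close>

lemma X_pgf:
  fixes z :: "'c :: {real_normed_field, banach, second_countable_topology}"
  assumes "1 \<le> i"
  shows "integrable M (\<lambda>x. z ^ X i x)"
    and "expectation (\<lambda>x. z ^ X i x) = exp (of_real (\<alpha> * real b) * (z - 1))"
proof -
  note [measurable] = X_measurable[OF assms]
  have pos: "\<alpha> * real b > 0"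
    using \<alpha> b by simp
  have "integrable (distr M (count_space UNIV) (X i)) (\<lambda>k. z ^ k)"
    unfolding distr[OF assms] by (rule poisson_pgf(1)[OF pos])
  then show "integrable M (\<lambda>x. z ^ X i x)"
    by (subst (asm) integrable_distr_eq) auto
  have "expectation (\<lambda>x. z ^ X i x) = (\<integral>k. z ^ k \<partial>distr M (count_space UNIV) (X i))"
    by (subst integral_distr) auto
  then show "expectation (\<lambda>x. z ^ X i x) = exp (of_real (\<alpha> * real b) * (z - 1))"
    unfolding distr[OF assms] poisson_pgf(2)[OF pos] .
qed

text \<open>The process $u^n z^{S_n}$ is a martingale when \<open>u E(z^X) = 1\<close>; here it is restricted to the
  event \<open>B > n\<close>, which depends on \<open>X 1, \<dots>, X n\<close> only.\<close>

lemma martingale_step: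
  fixes u z :: "'c :: {real_normed_field, banach, second_countable_topology}"
  assumes u: "u * exp (of_real (\<alpha> * real b) * (z - 1)) = 1"
    and int: "integrable M (\<lambda>x. indicator (longer n) x * (u ^ n * z ^ S n x))"
  shows "integrable M (\<lambda>x. indicator (longer n) x * (u ^ Suc n * z ^ S (Suc n) x))"
    and "expectation (\<lambda>x. indicator (longer n) x * (u ^ Suc n * z ^ S (Suc n) x))
      = expectation (\<lambda>x. indicator (longer n) x * (u ^ n * z ^ S n x))"
proof -
  let ?P = "\<lambda>A. PiM A (\<lambda>_. count_space UNIV) :: (nat \<Rightarrow> nat) measure"
  \<comment> \<open>\<open>h\<close> reads only the coordinates 1 to \<open>n\<close> and encodes
    \<open>longer n\<close> in them, while \<open>g\<close> reads only coordinate
    \<open>Suc n\<close>. Disjoint index sets make the two factors independent.\<close>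
  define h where "h = (\<lambda>\<omega>. if \<forall>i\<in>{1..n}. b * i \<le> (\<Sum>j=1..i. \<omega> j)
    then u ^ n * z ^ (\<Sum>j=1..n. \<omega> j) else 0 :: 'c)"
  define g where "g = (\<lambda>\<omega> :: nat \<Rightarrow> nat. u * z ^ \<omega> (Suc n))"
  have [measurable]: "(\<lambda>\<omega>. \<Sum>j=1..i. \<omega> j) \<in> ?P {1..n} \<rightarrow>\<^sub>M count_space UNIV" if "i \<le> n" for i
    by (intro measurable_sum_nat measurable_component_singleton) (use that in auto)
  have h: "h \<in> borel_measurable (?P {1..n})"
    unfolding h_def by measurable
  have g: "g \<in> borel_measurable (?P {Suc n})"
    unfolding g_def by measurable
  have "indep_var (?P {1..n}) (\<lambda>\<omega>. restrict (\<lambda>i. X i \<omega>) {1..n})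
      (?P {Suc n}) (\<lambda>\<omega>. restrict (\<lambda>i. X i \<omega>) {Suc n})"
    by (rule indep_var_restrict[OF indep]) auto
  from indep_var_compose[OF this h g]
  have ind: "indep_var borel (\<lambda>x. h (restrict (\<lambda>i. X i x) {1..n}))
      borel (\<lambda>x. g (restrict (\<lambda>i. X i x) {Suc n}))"
    by (simp add: comp_def)
  have H: "h (restrict (\<lambda>i. X i x) {1..n}) = indicator (longer n) x * (u ^ n * z ^ S n x)"
    if "x \<in> space M" for x
  proof -
    have "(\<Sum>j=1..i. restrict (\<lambda>i. X i x) {1..n} j) = S i x" if "i \<le> n" for i
      unfolding partial_sum_def using that by (intro sum.cong) auto
    then show ?thesis
      using \<open>x \<in> space M\<close> by (auto simp: h_def longer_def)
  qed
  have G: "g (restrict (\<lambda>i. X i x) {Suc n}) = u * z ^ X (Suc n) x" for x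
    by (simp add: g_def)
  have HG: "h (restrict (\<lambda>i. X i x) {1..n}) * g (restrict (\<lambda>i. X i x) {Suc n})
      = indicator (longer n) x * (u ^ Suc n * z ^ S (Suc n) x)" if "x \<in> space M" for x
    unfolding H[OF that] G by (simp add: partial_sum_def power_add mult_ac)
  have int': "integrable M (\<lambda>x. h (restrict (\<lambda>i. X i x) {1..n}))"
    using int by (simp only: H cong: Bochner_Integration.integrable_cong)
  have intg: "integrable M (\<lambda>x. g (restrict (\<lambda>i. X i x) {Suc n}))"
    unfolding G by (intro integrable_mult_right X_pgf) auto
  show "integrable M (\<lambda>x. indicator (longer n) x * (u ^ Suc n * z ^ S (Suc n) x))"
    using indep_var_integrable[OF ind int' intg]
    by (simp only: HG cong: Bochner_Integration.integrable_cong)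
  have "expectation (\<lambda>x. g (restrict (\<lambda>i. X i x) {Suc n})) = 1"
    unfolding G using u X_pgf[of "Suc n" z] by simp
  with indep_var_lebesgue_integral[OF ind int' intg]
  have "expectation (\<lambda>x. h (restrict (\<lambda>i. X i x) {1..n}) * g (restrict (\<lambda>i. X i x) {Suc n}))
      = expectation (\<lambda>x. h (restrict (\<lambda>i. X i x) {1..n}))"
    by (simp only: mult_1_right)
  moreover have "expectation (\<lambda>x. h (restrict (\<lambda>i. X i x) {1..n}) * g (restrict (\<lambda>i. X i x) {Suc n}))
      = expectation (\<lambda>x. indicator (longer n) x * (u ^ Suc n * z ^ S (Suc n) x))"
    by (intro Bochner_Integration.integral_cong refl HG)
  moreover have "expectation (\<lambda>x. h (restrict (\<lambda>i. X i x) {1..n}))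
      = expectation (\<lambda>x. indicator (longer n) x * (u ^ n * z ^ S n x))"
    by (intro Bochner_Integration.integral_cong refl H)
  ultimately show "expectation (\<lambda>x. indicator (longer n) x * (u ^ Suc n * z ^ S (Suc n) x))
      = expectation (\<lambda>x. indicator (longer n) x * (u ^ n * z ^ S n x))"
    by simp
qed

lemma integrable_martingale:
  fixes u z :: "'c :: {real_normed_field, banach, second_countable_topology}"
  assumes u: "u * exp (of_real (\<alpha> * real b) * (z - 1)) = 1"
  shows "integrable M (\<lambda>x. indicator (longer n) x * (u ^ n * z ^ S n x))"
proof (induction n)
  case 0
  show ?case by (simp add: partial_sum_def cong: Bochner_Integration.integrable_cong)
next
  case (Suc n)
  have eq: "indicator (longer (Suc n)) x * (u ^ Suc n * z ^ S (Suc n) x)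
      = indicator (longer (Suc n)) x *\<^sub>R (indicator (longer n) x * (u ^ Suc n * z ^ S (Suc n) x))" for x
    by (auto simp: longer_Suc indicator_def)
  show ?case
    unfolding eq by (intro integrable_mult_indicator longer_sets martingale_step(1)[OF u Suc])
qed

text \<open>On \<open>longer n\<close> the expectation does not change from time \<open>n\<close> to
  \<open>Suc n\<close>, so the part that stops at \<open>Suc n\<close> accounts for the whole drop.
  Summed over \<open>n\<close>, these drops telescope.\<close>

lemma expectation_longer_diff:
  fixes u z :: "'c :: {real_normed_field, banach, second_countable_topology}"
  assumes u: "u * exp (of_real (\<alpha> * real b) * (z - 1)) = 1"
  shows "expectation (\<lambda>x. indicator (longer n - longer (Suc n)) x * (u ^ Suc n * z ^ S (Suc n) x))
    = expectation (\<lambda>x. indicator (longer n) x * (u ^ n * z ^ S n x))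
      - expectation (\<lambda>x. indicator (longer (Suc n)) x * (u ^ Suc n * z ^ S (Suc n) x))"
proof -
  note step = martingale_step[OF u integrable_martingale[OF u]]
  have eq: "indicator (longer n - longer (Suc n)) x * (u ^ Suc n * z ^ S (Suc n) x)
      = indicator (longer n) x * (u ^ Suc n * z ^ S (Suc n) x)
        - indicator (longer (Suc n)) x * (u ^ Suc n * z ^ S (Suc n) x)" for x
    by (auto simp: longer_Suc indicator_def)
  show ?thesis
    unfolding eq step(2)[of n, symmetric]
    by (rule Bochner_Integration.integral_diff[OF step(1) integrable_martingale[OF u]])
qed

text \<open>The point $z = 1/\<alpha>$ minimises $E(z^{X - b})$, and \<open>1 / radius\<close> is the minimum.\<close>

lemma tail_bound:
  shows "integrable M (\<lambda>x. indicator (longer n) x * (1 / \<alpha>) ^ (S n x - b * n))"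
    and "expectation (\<lambda>x. indicator (longer n) x * (1 / \<alpha>) ^ (S n x - b * n)) \<le> 1 / radius ^ n"
proof -
  \<comment> \<open>This is \<open>q / z ^ b\<close> at \<open>q = radius\<close> and
    \<open>z = 1 / \<alpha>\<close>, the factor that makes the process a martingale at that
    point.\<close>
  define u where "u = radius * \<alpha> ^ b"
  have "u = exp (\<alpha> - 1) ^ b"
    using \<alpha> by (simp add: u_def radius_def power_divide)
  also have "\<dots> = exp (real b * (\<alpha> - 1))"
    by (rule exp_of_nat_mult[symmetric])
  finally have u: "u * exp (of_real (\<alpha> * real b) * (1 / \<alpha> - 1)) = 1"
    using \<alpha> by (simp flip: exp_add) (simp add: algebra_simps)
  have upos: "u > 0"
    using \<alpha> radius_gt_1 by (simp add: u_def)
  let ?W = "\<lambda>n x. indicator (longer n) x * (u ^ n * (1 / \<alpha>) ^ S n x)"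
  \<comment> \<open>All terms are nonnegative, so the part removed at each step can only lower the
    expectation from its initial value 1.\<close>
  have "expectation (?W n) \<le> 1"
  proof (induction n)
    case 0
    show ?case by (simp add: partial_sum_def prob_space cong: Bochner_Integration.integral_cong)
  next
    case (Suc n)
    have "0 \<le> expectation (\<lambda>x. indicator (longer n - longer (Suc n)) x * (u ^ Suc n * (1 / \<alpha>) ^ S (Suc n) x))"
      using upos \<alpha> by (intro Bochner_Integration.integral_nonneg) auto
    with Suc show ?case
      unfolding expectation_longer_diff[OF u] by linarith
  qed
  \<comment> \<open>On \<open>longer n\<close> the subtraction does not truncate, so the powers of
    \<alpha> in \<open>u ^ n\<close> cancel those of \<open>b * n\<close>.\<close>
  moreover have W: "indicator (longer n) x * (1 / \<alpha>) ^ (S n x - b * n) = ?W n x / radius ^ n" for x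
  proof (cases "x \<in> longer n")
    case True
    define m where "m = S n x - b * n"
    have "S n x = b * n + m"
      using longer_le[OF True] by (simp add: m_def)
    then show ?thesis
      using True \<alpha> radius_gt_1 unfolding m_def[symmetric]
      by (simp add: u_def power_add power_mult_distrib power_mult power_divide)
  qed simp
  ultimately show "expectation (\<lambda>x. indicator (longer n) x * (1 / \<alpha>) ^ (S n x - b * n)) \<le> 1 / radius ^ n"
    using radius_gt_1 by (simp add: divide_right_mono)
  show "integrable M (\<lambda>x. indicator (longer n) x * (1 / \<alpha>) ^ (S n x - b * n))"
    unfolding W by (intro integrable_divide integrable_martingale u)
qed

text \<open>The weight in \<open>tail_bound\<close> is a natural power of 1/\<alpha> and hence at
  least 1.\<close>

lemma prob_longer: "prob (longer n) \<le> 1 / radius ^ n"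
proof -
  have "prob (longer n) = expectation (indicator (longer n))"
    by simp
  also have "\<dots> \<le> expectation (\<lambda>x. indicator (longer n) x * (1 / \<alpha>) ^ (S n x - b * n))"
    using \<alpha> by (intro integral_mono tail_bound integrable_real_indicator)
      (auto simp: indicator_def less_top[symmetric] intro!: one_le_power)
  also have "\<dots> \<le> 1 / radius ^ n"
    by (rule tail_bound)
  finally show ?thesis .
qed

text \<open>A point whose block never ends lies in every \<open>longer n\<close>, and the
  probabilities of these events tend to 0.\<close>

lemma AE_block_ends: "AE x in M. block_ends b X x"
proof (rule AE_I)
  let ?N = "\<Inter>n. longer n"
  show "{x \<in> space M. \<not> block_ends b X x} \<subseteq> ?N"
    by (auto simp: longer_iff)
  show [measurable]: "?N \<in> sets M"
    by measurable
  have "prob ?N \<le> 1 / radius ^ n" for n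
    using finite_measure_mono[of ?N "longer n"] prob_longer[of n] by force
  moreover have "(\<lambda>n. 1 / radius ^ n) \<longlonglongrightarrow> 0"
    using LIMSEQ_inverse_realpow_zero[OF radius_gt_1] by (simp add: divide_inverse)
  ultimately have "prob ?N \<le> 0"
    by (intro LIMSEQ_le_const) auto
  then show "emeasure M ?N = 0"
    by (simp add: emeasure_eq_measure measure_le_0_iff)
qed

section \<open>Optional stopping at the end of the block\<close>

text \<open>The expectation is split by the value of \<open>B\<close>, where
  \<open>longer n - longer (Suc n)\<close> is the event \<open>B = Suc n\<close>. Growth
  \<open>c ^ B\<close> against the tail \<open>1 / radius ^ n\<close> gives a geometric series of
  ratio \<open>c / radius\<close>, which justifies exchanging sum and integral.\<close>

lemma block_length_expansion:
  fixes g :: "'a \<Rightarrow> 'c :: {real_normed_field, banach, second_countable_topology}"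
  assumes [measurable]: "g \<in> borel_measurable M"
    and c: "0 \<le> c" "c < radius"
    and g: "\<And>x. x \<in> space M \<Longrightarrow> block_ends b X x \<Longrightarrow> norm (g x) \<le> C * c ^ B x"
  shows "integrable M g"
    and "(\<lambda>n. expectation (\<lambda>x. indicator (longer n - longer (Suc n)) x * g x)) sums expectation g"
proof -
  define f where "f = (\<lambda>n x. indicator (longer n - longer (Suc n)) x * g x)"
  have [measurable]: "f n \<in> borel_measurable M" for n
    unfolding f_def by measurable
  have ends: "x \<in> space M \<and> block_ends b X x \<and> B x = Suc n"
    if "x \<in> longer n - longer (Suc n)" for n x
    using that by (auto simp: longer_iff)
  have norm_f: "norm (f n x) \<le> indicator (longer n) x * (\<bar>C\<bar> * c ^ Suc n)" for n x
  proof (cases "x \<in> longer n - longer (Suc n)")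
    case True
    have "norm (g x) \<le> C * c ^ Suc n"
      using g[of x] ends[OF True] by simp
    also have "\<dots> \<le> \<bar>C\<bar> * c ^ Suc n"
      using c by (intro mult_right_mono) auto
    finally show ?thesis
      using True by (simp add: f_def)
  qed (use c in \<open>simp add: f_def\<close>)
  have int: "integrable M (f n)" for n
    by (rule Bochner_Integration.integrable_bound[where f = "\<lambda>x. indicator (longer n) x * (\<bar>C\<bar> * c ^ Suc n)"])
      (use norm_f c in \<open>auto simp: less_top[symmetric]\<close>)
  have f_eq: "f n x = (if n = B x - 1 then g x else 0)" if "x \<in> space M" "block_ends b X x" for n x
    using that block_length_props(1)[OF that(2)] by (auto simp: f_def longer_iff indicator_def)
  have sm: "AE x in M. summable (\<lambda>n. norm (f n x))"
    using AE_block_ends AE_space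
  proof eventually_elim
    case (elim x)
    then show ?case
      by (intro summable_finite[of "{B x - 1}"]) (auto simp: f_eq)
  qed
  have ss: "summable (\<lambda>n. \<integral>x. norm (f n x) \<partial>M)"
  proof (rule summable_comparison_test)
    have "(\<integral>x. norm (f n x) \<partial>M) \<le> \<bar>C\<bar> * c * (c / radius) ^ n" for n
    proof -
      have "(\<integral>x. norm (f n x) \<partial>M) \<le> (\<integral>x. indicator (longer n) x * (\<bar>C\<bar> * c ^ Suc n) \<partial>M)"
        by (intro integral_mono integrable_norm int norm_f) (auto simp: less_top[symmetric])
      also have "\<dots> = prob (longer n) * (\<bar>C\<bar> * c ^ Suc n)"
        by simp
      also have "\<dots> \<le> 1 / radius ^ n * (\<bar>C\<bar> * c ^ Suc n)"
        using c by (intro mult_right_mono prob_longer) auto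
      finally show ?thesis
        by (simp add: power_divide mult_ac)
    qed
    then show "\<exists>N. \<forall>n\<ge>N. norm (\<integral>x. norm (f n x) \<partial>M) \<le> \<bar>C\<bar> * c * (c / radius) ^ n"
      by (simp add: integral_nonneg_AE)
    show "summable (\<lambda>n. \<bar>C\<bar> * c * (c / radius) ^ n)"
      using c radius_gt_1 by (intro summable_mult summable_geometric) auto
  qed
  have lim: "AE x in M. (\<Sum>n. f n x) = g x"
    using AE_block_ends AE_space
  proof eventually_elim
    case (elim x)
    then have "(\<Sum>n. f n x) = (\<Sum>n. if n = B x - 1 then g x else 0)"
      by (intro suminf_cong) (simp add: f_eq)
    then show ?case
      using sums_If_finite_set[of "{B x - 1}" "\<lambda>_. g x"] by (simp add: sums_iff)
  qed
  have "integrable M (\<lambda>x. \<Sum>n. f n x)"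
    by (rule integrable_suminf[OF int sm ss])
  then show "integrable M g"
    using lim by (subst (asm) integrable_cong_AE) auto
  have "(\<lambda>n. expectation (f n)) sums expectation (\<lambda>x. \<Sum>n. f n x)"
    by (rule sums_integral[OF int sm ss])
  also have "expectation (\<lambda>x. \<Sum>n. f n x) = expectation g"
    using lim by (intro integral_cong_AE) auto
  finally show "(\<lambda>n. expectation (\<lambda>x. indicator (longer n - longer (Suc n)) x * g x)) sums expectation g"
    by (simp add: f_def)
qed

text \<open>This provides the growth hypothesis of \<open>block_length_expansion\<close> with
  \<open>c = norm q\<close>. The maximum with 1 makes the constant independent of \<open>Y\<close>,
  also when \<open>norm t < 1\<close>.\<close>

lemma norm_block_le:
  fixes q t :: complex
  assumes "block_ends b X x"
  shows "norm (q ^ B x * t ^ Y x) \<le> max 1 (norm t) ^ b * norm q ^ B x"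
proof -
  have "norm t ^ Y x \<le> max 1 (norm t) ^ Y x"
    by (intro power_mono) auto
  also have "\<dots> \<le> max 1 (norm t) ^ b"
    using last_bucket_eq(2)[OF assms] by (intro power_increasing) auto
  finally show ?thesis
    by (simp add: norm_mult norm_power mult.commute[of "norm q ^ _"] mult_right_mono)
qed

lemma integrable_block:
  fixes q t :: complex
  assumes "norm q < radius"
  shows "integrable M (\<lambda>x. q ^ B x * t ^ Y x)"
  by (rule block_length_expansion(1)[OF _ _ assms norm_block_le]) auto

text \<open>Optional stopping for the martingale with \<open>u = q / z ^ b\<close>. The contribution
  of \<open>B > n\<close> vanishes in the limit, so the stopped parts sum to the initial value 1;
  multiplication by \<open>z ^ b\<close> turns them into the required expectation.\<close>

lemma expectation_at_root:
  fixes q z :: complex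
  assumes q: "norm q < radius" and z: "z \<noteq> 0" "norm z \<le> 1 / \<alpha>"
    and root: "z ^ b = q * exp (of_real (\<alpha> * real b) * (z - 1))"
  shows "expectation (\<lambda>x. q ^ B x * z ^ Y x) = z ^ b"
proof -
  define u where "u = q / z ^ b"
  have "q \<noteq> 0" using z root by auto
  then have u: "u * exp (of_real (\<alpha> * real b) * (z - 1)) = 1"
    by (simp add: u_def root)
  define a where "a = (\<lambda>n. expectation (\<lambda>x. indicator (longer n) x * (u ^ n * z ^ S n x)))"
  have a0: "a 0 = 1"
    by (simp add: a_def partial_sum_def prob_space cong: Bochner_Integration.integral_cong)
  \<comment> \<open>On \<open>longer n\<close> the modulus of the integrand is
    \<open>norm q ^ n * norm z ^ (S n x - b * n)\<close>. With
    \<open>norm z \<le> 1 / \<alpha>\<close> it is dominated by the integrand of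
    \<open>tail_bound\<close>.\<close>
  have "norm (a n) \<le> (norm q / radius) ^ n" for n
  proof -
    have le: "norm (indicator (longer n) x * (u ^ n * z ^ S n x))
        \<le> norm q ^ n * (indicator (longer n) x * (1 / \<alpha>) ^ (S n x - b * n))" for x
    proof (cases "x \<in> longer n")
      case True
      define m where "m = S n x - b * n"
      have "S n x = b * n + m"
        using longer_le[OF True] by (simp add: m_def)
      then have "u ^ n * z ^ S n x = q ^ n * z ^ m"
        using z by (simp add: u_def power_add power_mult power_divide)
      then have "norm (u ^ n * z ^ S n x) = norm q ^ n * norm z ^ m"
        by (simp add: norm_mult norm_power)
      also have "\<dots> \<le> norm q ^ n * (1 / \<alpha>) ^ m"
        using z by (intro mult_left_mono power_mono) auto
      finally show ?thesis
        using True by (simp add: m_def)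
    qed simp
    have "norm (a n) \<le> expectation (\<lambda>x. norm (indicator (longer n) x * (u ^ n * z ^ S n x)))"
      unfolding a_def by (rule integral_norm_bound)
    also have "\<dots> \<le> expectation (\<lambda>x. norm q ^ n * (indicator (longer n) x * (1 / \<alpha>) ^ (S n x - b * n)))"
      by (intro integral_mono integrable_norm integrable_martingale[OF u] integrable_mult_right
          tail_bound le)
    also have "\<dots> \<le> norm q ^ n * (1 / radius ^ n)"
      by (subst integral_mult_right_zero) (intro mult_left_mono tail_bound, simp)
    finally show ?thesis
      by (simp add: power_divide)
  qed
  moreover have "(\<lambda>n. (norm q / radius) ^ n) \<longlonglongrightarrow> 0"
    using q radius_gt_1 by (intro LIMSEQ_realpow_zero) auto
  ultimately have "a \<longlonglongrightarrow> 0"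
    by (rule Lim_null_comparison[OF always_eventually[OF allI]])
  from telescope_sums'[OF this] have "(\<lambda>n. z ^ b * (a n - a (Suc n))) sums z ^ b"
    using sums_mult[of _ "1 :: complex" "z ^ b"] by (simp add: a0)
  also have "(\<lambda>n. z ^ b * (a n - a (Suc n)))
      = (\<lambda>n. expectation (\<lambda>x. indicator (longer n - longer (Suc n)) x * (q ^ B x * z ^ Y x)))"
  proof
    fix n
    \<comment> \<open>When \<open>B = Suc n\<close>, \<open>u ^ Suc n\<close> divides by
      \<open>z ^ (b * Suc n)\<close> but \<open>S (Suc n) x\<close> is only
      \<open>b * n + Y x\<close>. The extra factor \<open>z ^ b\<close> makes up for this one block
      of difference.\<close>
    have "z ^ b * (indicator (longer n - longer (Suc n)) x * (u ^ Suc n * z ^ S (Suc n) x))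
        = indicator (longer n - longer (Suc n)) x * (q ^ B x * z ^ Y x)" for x
    proof (cases "x \<in> longer n - longer (Suc n)")
      case True
      then have x: "block_ends b X x" "B x = Suc n"
        by (auto simp: longer_iff)
      have "S (Suc n) x = b * n + Y x"
        using block_length_props(3)[OF x(1)] by (simp add: last_bucket_def x(2) mult.commute)
      then show ?thesis
        using True z by (simp add: x(2) u_def power_add power_mult power_divide)
    qed simp
    then show "z ^ b * (a n - a (Suc n))
        = expectation (\<lambda>x. indicator (longer n - longer (Suc n)) x * (q ^ B x * z ^ Y x))"
      unfolding a_def expectation_longer_diff[OF u, symmetric]
      by (simp only: flip: integral_mult_right_zero)
  qed
  finally have "(\<lambda>n. expectation (\<lambda>x. indicator (longer n - longer (Suc n)) x * (q ^ B x * z ^ Y x)))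
      sums z ^ b" .
  moreover have "(\<lambda>n. expectation (\<lambda>x. indicator (longer n - longer (Suc n)) x * (q ^ B x * z ^ Y x)))
      sums expectation (\<lambda>x. q ^ B x * z ^ Y x)"
    by (rule block_length_expansion(2)[OF _ _ q norm_block_le]) auto
  ultimately show ?thesis
    by (rule sums_unique2[symmetric])
qed

section \<open>Identification of the polynomial by its roots\<close>

text \<open>Almost surely \<open>Y < b\<close>, so \<open>t ^ b\<close> minus the expectation is a
  monic polynomial in \<open>t\<close> of degree \<open>b\<close>, and the \<open>b\<close> distinct
  \<open>zeta\<close> values are its roots.\<close>

lemma expectation_block_eq_prod:
  fixes q r t :: complex
  assumes q: "norm q < radius" and r: "r ^ b = q"
  shows "expectation (\<lambda>x. q ^ B x * t ^ Y x) = t ^ b - (\<Prod>l<b. t - zeta b \<alpha> r l)"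
proof (cases "q = 0")
  \<comment> \<open>At \<open>q = 0\<close> all \<open>zeta\<close> values collapse to 0, so
    counting distinct roots fails. Here the expectation vanishes directly because
    \<open>B \<ge> 1\<close> almost surely.\<close>
  case True
  then have "r = 0"
    using r by simp
  then have "zeta b \<alpha> r l = 0" for l
    by (simp add: zeta_def treeT_def)
  then have "t ^ b - (\<Prod>l<b. t - zeta b \<alpha> r l) = 0"
    by simp
  moreover have "expectation (\<lambda>x. q ^ B x * t ^ Y x) = expectation (\<lambda>x. 0)"
  proof (rule integral_cong_AE)
    show "AE x in M. q ^ B x * t ^ Y x = 0"
      using AE_block_ends
    proof eventually_elim
      case (elim x)
      with block_length_props(1)[OF elim] True show ?case by simp
    qed
  qed auto
  ultimately show ?thesis
    by simp
next
  case False
  with r b have r0: "r \<noteq> 0"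
    by auto
  have "norm r ^ b < (exp (\<alpha> - 1) / \<alpha>) ^ b"
    using q r by (simp add: radius_def norm_power[symmetric])
  then have r': "norm r < exp (\<alpha> - 1) / \<alpha>"
    using \<alpha> by (auto intro: power_less_imp_less_base)
  let ?Z = "zeta b \<alpha> r ` {..<b}"
  define e where "e = (\<lambda>y. expectation (\<lambda>x. q ^ B x * (if Y x = y then 1 else 0)))"
  define p where "p = monom 1 b - (\<Sum>y<b. monom (e y) y)"
  define p' where "p' = (\<Prod>l<b. [:- zeta b \<alpha> r l, 1:])"
  have poly_p: "poly p t = t ^ b - expectation (\<lambda>x. q ^ B x * t ^ Y x)" for t
  proof -
    have int: "integrable M (\<lambda>x. q ^ B x * (if Y x = y then 1 else 0))" for y
      by (rule Bochner_Integration.integrable_bound[OF integrable_block[OF q, of 1]]) auto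
    have "expectation (\<lambda>x. q ^ B x * t ^ Y x)
        = expectation (\<lambda>x. \<Sum>y<b. t ^ y * (q ^ B x * (if Y x = y then 1 else 0)))"
    proof (rule integral_cong_AE)
      show "AE x in M. q ^ B x * t ^ Y x = (\<Sum>y<b. t ^ y * (q ^ B x * (if Y x = y then 1 else 0)))"
        using AE_block_ends
      proof eventually_elim
        case (elim x)
        then show ?case
          using last_bucket_eq(2)[OF elim] by (simp add: if_distrib[of "\<lambda>c. _ * c"] sum.delta' cong: if_cong)
      qed
    qed auto
    also have "\<dots> = (\<Sum>y<b. t ^ y * e y)"
      unfolding e_def by (subst Bochner_Integration.integral_sum) (auto intro: int)
    finally show ?thesis
      by (simp add: p_def poly_sum poly_monom mult.commute)
  qed
  have "p = p'"
  \<comment> \<open>With the coefficients at \<open>b\<close> equal, the difference has degree below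
    \<open>b\<close>, so agreement at \<open>b\<close> points suffices.\<close>
  proof (rule poly_eqI_degree_lead_coeff)
    have deg_e: "degree (\<Sum>y<b. monom (e y) y) < b"
      using b by (intro degree_sum_less) (auto intro: le_less_trans[OF degree_monom_le])
    then show "degree p \<le> b"
      unfolding p_def by (intro degree_diff_le degree_monom_le) auto
    have deg: "degree p' = b"
      unfolding p'_def by (subst degree_prod_eq_sum_degree) auto
    then show "degree p' \<le> b"
      by simp
    have "lead_coeff p' = 1"
      unfolding p'_def by (simp add: lead_coeff_prod)
    then show "coeff p b = coeff p' b"
      using deg deg_e by (simp add: p_def coeff_eq_0)
    show "b \<le> card ?Z"
      by (simp add: card_image inj_on_zeta[OF \<alpha>(1) r' r0])
    show "poly p z = poly p' z" if "z \<in> ?Z" for z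
    proof -
      obtain l where l: "l < b" "z = zeta b \<alpha> r l"
        using \<open>z \<in> ?Z\<close> by auto
      have "poly p' z = 0"
        using l by (auto simp: p'_def poly_prod)
      moreover have "expectation (\<lambda>x. q ^ B x * z ^ Y x) = z ^ b"
        unfolding l(2)
        using zeta_neq_0[OF \<alpha>(1) r' r0] zeta_fixed_point(2)[OF \<alpha>(1) r'] zeta_power[OF b \<alpha>(1) r'] r
        by (intro expectation_at_root q) auto
      ultimately show ?thesis
        by (simp add: poly_p)
    qed
  qed
  then have "poly p t = (\<Prod>l<b. t - zeta b \<alpha> r l)"
    by (simp add: p'_def poly_prod)
  with poly_p[of t] show ?thesis
    by (simp add: algebra_simps)
qed

end

theorem theorem10p4:
  fixes M :: "'a measure" and X :: "nat \<Rightarrow> 'a \<Rightarrow> nat" and b :: nat and \<alpha> :: real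
  assumes "prob_space M"
    and "b \<ge> 1" and "0 < \<alpha>" and "\<alpha> < 1"
    and "prob_space.indep_vars M (\<lambda>_. count_space UNIV) X {1..}"
    and "\<And>i. i \<ge> 1 \<Longrightarrow>
           distr M (count_space UNIV) (X i) = measure_pmf (poisson_pmf (\<alpha> * real b))"
  shows "(AE x in M. block_ends b X x) \<and>
    (\<exists>R>1. R \<le> (exp (\<alpha> - 1) / \<alpha>) ^ b \<and>
      (\<forall>q r :: complex. norm q \<le> R \<longrightarrow> r ^ b = q \<longrightarrow>
        (\<forall>t :: complex.
          integrable M (\<lambda>x. q ^ block_length b X x * t ^ last_bucket b X x) \<and>
          (\<integral>x. q ^ block_length b X x * t ^ last_bucket b X x \<partial>M)
            = t ^ b - (\<Prod>l<b. t - zeta b \<alpha> r l)) \<and>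
        integrable M (\<lambda>x. q ^ block_length b X x) \<and>
        (\<integral>x. q ^ block_length b X x \<partial>M) = 1 - (\<Prod>l<b. 1 - zeta b \<alpha> r l)))"
proof -
  interpret linear_probing M X b \<alpha>
    using assms by (simp add: linear_probing_def linear_probing_axioms_def)
  \<comment> \<open>\<open>R\<close> stays strictly below \<open>radius\<close> so that the closed
    disc of radius \<open>R\<close> lies inside the open disc where the roots are
    controlled.\<close>
  obtain R where R: "1 < R" "R < radius"
    using dense[OF radius_gt_1] by blast
  have *: "integrable M (\<lambda>x. q ^ B x * t ^ Y x)"
    "expectation (\<lambda>x. q ^ B x * t ^ Y x) = t ^ b - (\<Prod>l<b. t - zeta b \<alpha> r l)"
    if "norm q \<le> R" "r ^ b = q" for q r t :: complex
    using that R integrable_block[of q t] expectation_block_eq_prod[of q r t] by auto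
  \<comment> \<open>The instance \<open>t = 1\<close> gives the generating function of
    \<open>B\<close> alone.\<close>
  from * *[of _ _ 1] show ?thesis
    using R AE_block_ends
    by (intro conjI exI[of _ R] allI impI) (simp_all add: radius_def)
qed

end
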